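(* Let $\tau$ be a nonzero cardinal number and let $A\subseteq\mathbb{C}$ be conjugate invariant, i.e. $\overline{\lambda}\in A$ for each $\lambda\in A$. Let $\varphi:\tau\to\tau$ be a self-map and $w=(w_\alpha)_{\alpha\in\tau}\in A^\tau$ be such that $\sigma_{\varphi,w}(\ell^2(\tau))\subseteq\ell^2(\tau)$. Then the adjoint of the $A$-weighted generalized shift operator $\sigma_{\varphi,w}\restriction_{\ell^2(\tau)}:\ell^2(\tau)\to\ell^2(\tau)$ is a convergent series of $A\cup\{0\}$-weighted generalized shifts on $\ell^2_p(\tau)$; that is, there exist self-maps $\eta_i:\tau\to\tau$ and weight vectors $u_i\in(A\cup\{0\})^\tau$ ($i\geq 1$) with $\sigma_{\eta_i,u_i}(\ell^2(\tau))\subseteq\ell^2(\tau)$ for each $i\geq1$, such that for every $y\in\ell^2(\tau)$ $$\left(\sigma_{\varphi,w}\restriction_{\ell^2(\tau)}\right)^*(y)=\sum_{i\geq1}\sigma_{\eta_i,u_i}(y),$$ where the series converges in $\ell^2_p(\tau)$.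
   Context: For a nonzero cardinal number $\tau$ (regarded as a set), $\ell^2(\tau)=\{x\in\mathbb{C}^\tau: \sum_{\alpha\in\tau}|x_\alpha|^2<\infty\}$ is the complex Hilbert space with inner product $\langle x,y\rangle=\sum_{\alpha\in\tau}x_\alpha\overline{y_\alpha}$. For a self-map $\varphi:\tau\to\tau$ and a weight vector $w=(w_\alpha)_{\alpha\in\tau}\in\mathbb{C}^\tau$, the weighted generalized shift is the linear map $\sigma_{\varphi,w}:\mathbb{C}^\tau\to\mathbb{C}^\tau$, $(x_\alpha)_{\alpha\in\tau}\mapsto(w_\alpha x_{\varphi(\alpha)})_{\alpha\in\tau}$; it is called an $A$-weighted generalized shift if $w_\alpha\in A$ for every $\alpha\in\tau$. It is known that if $\sigma_{\varphi,w}(\ell^2(\tau))\subseteq\ell^2(\tau)$ then $\sigma_{\varphi,w}\restriction_{\ell^2(\tau)}:\ell^2(\tau)\to\ell^2(\tau)$ is automatically a bounded operator, and that this inclusion holds if and only if $\sup\{(\sum_{\alpha\in\varphi^{-1}(\beta)}|w_\alpha|^2)^{1/2}:\beta\in\varphi(\tau)\}<+\infty$. $T^*$ denotes the Hilbert space adjoint of a bounded operator $T$. $\ell^2_p(\tau)$ denotes the set $\ell^2(\tau)$ equipped with the topology of pointwise (coordinatewise) convergence, i.e. the subspace topology inherited from the product topology of $\mathbb{C}^\tau$; thus a series in $\ell^2_p(\tau)$ converges to a given element if and only if, for each coordinate $\theta\in\tau$, the series of $\theta$-th coordinates converges in $\mathbb{C}$ to the $\theta$-th coordinate of that element. *)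

theory Defs
  imports "HOL-Analysis.Analysis"
begin

text \<open>The index set \<open>\<tau>\<close> is the universe of the type \<open>'a\<close> (nonempty, as all types are), and
  \<open>\<complex>\<^sup>\<tau>\<close> is the type \<open>'a \<Rightarrow> complex\<close>.\<close>

definition l2 :: "('a \<Rightarrow> complex) set" where
  "l2 = {x. (\<lambda>\<alpha>. (cmod (x \<alpha>))\<^sup>2) summable_on UNIV}"

definition l2_inner :: "('a \<Rightarrow> complex) \<Rightarrow> ('a \<Rightarrow> complex) \<Rightarrow> complex" where
  "l2_inner x y = (\<Sum>\<^sub>\<infinity>\<alpha>. x \<alpha> * cnj (y \<alpha>))"

definition wgs :: "('a \<Rightarrow> 'a) \<Rightarrow> ('a \<Rightarrow> complex) \<Rightarrow> ('a \<Rightarrow> complex) \<Rightarrow> ('a \<Rightarrow> complex)" where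
  "wgs \<phi> w x = (\<lambda>\<alpha>. w \<alpha> * x (\<phi> \<alpha>))"

definition weighted_in :: "complex set \<Rightarrow> ('a \<Rightarrow> complex) \<Rightarrow> bool" where
  "weighted_in A w \<longleftrightarrow> (\<forall>\<alpha>. w \<alpha> \<in> A)"

definition conjugate_invariant :: "complex set \<Rightarrow> bool" where
  "conjugate_invariant A \<longleftrightarrow> (\<forall>z\<in>A. cnj z \<in> A)"

text \<open>The Hilbert space adjoint of the restriction of \<open>T\<close> to \<open>l2\<close>; only the values of \<open>T\<close> on
  \<open>l2\<close> enter. It is meaningful at \<open>y \<in> l2\<close> when \<open>T\<close> restricts to a bounded operator on \<open>l2\<close>: the
  vector described then exists by the Riesz representation theorem. It is unique whenever it
  exists, see \<open>l2_adjoint_eqI\<close> below.\<close>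

definition l2_adjoint ::
    "(('a \<Rightarrow> complex) \<Rightarrow> ('a \<Rightarrow> complex)) \<Rightarrow> ('a \<Rightarrow> complex) \<Rightarrow> ('a \<Rightarrow> complex)" where
  "l2_adjoint T y = (THE z. z \<in> l2 \<and> (\<forall>x\<in>l2. l2_inner (T x) y = l2_inner x z))"

definition l2p :: "('a \<Rightarrow> complex) topology" where
  "l2p = subtopology (product_topology (\<lambda>_. euclidean) UNIV) l2"

lemma l2_inner_summable:
  assumes "x \<in> l2" "y \<in> l2"
  shows "(\<lambda>\<alpha>. x \<alpha> * cnj (y \<alpha>)) summable_on UNIV"
proof -
  have s: "(\<lambda>\<alpha>. (cmod (x \<alpha>))\<^sup>2 + (cmod (y \<alpha>))\<^sup>2) summable_on UNIV"
    using assms by (auto simp: l2_def intro: summable_on_add)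
  have "(\<lambda>\<alpha>. norm (x \<alpha> * cnj (y \<alpha>))) summable_on UNIV"
  proof (rule summable_on_comparison_test[OF s])
    fix \<alpha>
    have "0 \<le> (cmod (x \<alpha>) - cmod (y \<alpha>))\<^sup>2" "0 \<le> cmod (x \<alpha>) * cmod (y \<alpha>)" by simp_all
    then show "norm (x \<alpha> * cnj (y \<alpha>)) \<le> (cmod (x \<alpha>))\<^sup>2 + (cmod (y \<alpha>))\<^sup>2"
      unfolding norm_mult complex_mod_cnj power2_diff by linarith
  qed simp_all
  then show ?thesis by (rule abs_summable_summable)
qed

lemma l2_inner_unit: "l2_inner (\<lambda>\<alpha>. if \<alpha> = \<theta> then 1 else 0) z = cnj (z \<theta>)"
proof -
  have "l2_inner (\<lambda>\<alpha>. if \<alpha> = \<theta> then 1 else 0) z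
      = (\<Sum>\<^sub>\<infinity>\<alpha>\<in>{\<theta>}. cnj (z \<alpha>))"
    unfolding l2_inner_def by (rule infsum_cong_neutral) auto
  then show ?thesis by simp
qed

lemma unit_in_l2: "(\<lambda>\<alpha>. if \<alpha> = \<theta> then 1 else 0) \<in> l2"
proof -
  have "(\<lambda>\<alpha>. (cmod (if \<alpha> = \<theta> then 1 else 0))\<^sup>2) summable_on UNIV
      \<longleftrightarrow> (\<lambda>\<alpha>. 1 :: real) summable_on {\<theta>}"
    by (rule summable_on_cong_neutral) auto
  then show ?thesis by (simp add: l2_def)
qed

lemma l2_adjoint_eqI:
  assumes "z \<in> l2" "\<And>x. x \<in> l2 \<Longrightarrow> l2_inner (T x) y = l2_inner x z"
  shows "l2_adjoint T y = z"
  unfolding l2_adjoint_def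
proof (rule the_equality)
  fix z' assume "z' \<in> l2 \<and> (\<forall>x\<in>l2. l2_inner (T x) y = l2_inner x z')"
  then have "l2_inner x z' = l2_inner x z" if "x \<in> l2" for x using assms(2) that by metis
  from this[OF unit_in_l2] show "z' = z" by (auto simp: l2_inner_unit)
qed (use assms in auto)

lemma limitin_l2p_iff:
  "limitin l2p s z sequentially \<longleftrightarrow>
     z \<in> l2 \<and> (\<forall>\<^sub>F n in sequentially. s n \<in> l2) \<and> (\<forall>\<theta>. (\<lambda>n. s n \<theta>) \<longlonglongrightarrow> z \<theta>)"
  by (auto simp: l2p_def limitin_subtopology limitin_componentwise)

end

theory Submission
  imports Defs
begin

text \<open>The adjoint is \<open>(T\<^sup>* y) \<theta> = \<Sum>\<alpha> \<in> \<phi>\<^sup>-\<^sup>1(\<theta>). cnj (w \<alpha>) * y \<alpha>\<close>. Since \<open>T\<close> maps the unit vector at \<open>\<theta>\<close>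
  into \<open>l2\<close>, only countably many \<open>\<alpha>\<close> in the fibre over \<open>\<theta>\<close> have \<open>w \<alpha> \<noteq> 0\<close>; the \<open>i\<close>-th shift
  picks the \<open>i\<close>-th of them in every fibre, with weight \<open>0\<close> where the fibre is exhausted.
  Membership in \<open>l2\<close> rests on the uniform bound for the sums of \<open>(cmod (w \<alpha>))\<^sup>2\<close> over fibres, which
  is obtained by a gliding hump argument.\<close>

section \<open>Regrouping sums along the fibres of a self-map\<close>

lemma bij_betw_snd_fibres:
  "bij_betw snd (SIGMA \<theta>:UNIV. \<phi> -` {\<theta>}) UNIV"
  by (rule bij_betwI[where g = "\<lambda>\<alpha>. (\<phi> \<alpha>, \<alpha>)"]) auto

text \<open>The fibres of \<phi> partition the index set, so the pairs (\<theta>, \<alpha>) with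
  \<alpha> over \<theta> merely relabel the indices \<alpha>. In this form the Fubini rules for
  \<open>Sigma\<close> apply.\<close>

lemma summable_on_Sigma_fibres:
  assumes "f summable_on UNIV"
  shows "(\<lambda>(\<theta>, \<alpha>). f \<alpha>) summable_on (SIGMA \<theta>:UNIV. \<phi> -` {\<theta>})"
  using assms summable_on_reindex_bij_betw[OF bij_betw_snd_fibres, of f]
  by (simp add: case_prod_unfold)

lemma summable_on_fibres:
  fixes f :: "'a \<Rightarrow> 'b::banach"
  assumes "f summable_on UNIV"
  shows "(\<lambda>\<theta>. \<Sum>\<^sub>\<infinity>\<alpha>\<in>\<phi> -` {\<theta>}. f \<alpha>) summable_on UNIV"
  using summable_on_Sigma_fibres[OF assms] by (rule summable_on_Sigma_banach)

lemma infsum_fibres: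
  fixes f :: "'a \<Rightarrow> 'b::banach"
  assumes "f summable_on UNIV"
  shows "(\<Sum>\<^sub>\<infinity>\<theta>. \<Sum>\<^sub>\<infinity>\<alpha>\<in>\<phi> -` {\<theta>}. f \<alpha>) = (\<Sum>\<^sub>\<infinity>\<alpha>. f \<alpha>)"
proof -
  have "(\<Sum>\<^sub>\<infinity>\<theta>. \<Sum>\<^sub>\<infinity>\<alpha>\<in>\<phi> -` {\<theta>}. f \<alpha>)
      = (\<Sum>\<^sub>\<infinity>(\<theta>, \<alpha>)\<in>(SIGMA \<theta>:UNIV. \<phi> -` {\<theta>}). f \<alpha>)"
    using summable_on_Sigma_fibres[OF assms] by (rule infsum_Sigma'_banach)
  also have "\<dots> = (\<Sum>\<^sub>\<infinity>p\<in>(SIGMA \<theta>:UNIV. \<phi> -` {\<theta>}). f (snd p))"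
    by (simp add: case_prod_unfold)
  also have "\<dots> = (\<Sum>\<^sub>\<infinity>\<alpha>. f \<alpha>)"
    by (rule infsum_reindex_bij_betw[OF bij_betw_snd_fibres])
  finally show ?thesis .
qed

section \<open>Two analytic tools: Cauchy-Schwarz and a gliding hump\<close>

text \<open>Every finite partial sum obeys the bound by the finite inequality for moduli, and the
  bound survives the limit along the finite subsets of \<open>S\<close>.\<close>

lemma infsum_Cauchy_Schwarz:
  fixes a b :: "'a \<Rightarrow> complex"
  assumes a: "(\<lambda>\<alpha>. (cmod (a \<alpha>))\<^sup>2) summable_on S"
    and b: "(\<lambda>\<alpha>. (cmod (b \<alpha>))\<^sup>2) summable_on S"
    and ab: "(\<lambda>\<alpha>. a \<alpha> * b \<alpha>) summable_on S"
  shows "(cmod (\<Sum>\<^sub>\<infinity>\<alpha>\<in>S. a \<alpha> * b \<alpha>))\<^sup>2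
    \<le> (\<Sum>\<^sub>\<infinity>\<alpha>\<in>S. (cmod (a \<alpha>))\<^sup>2) * (\<Sum>\<^sub>\<infinity>\<alpha>\<in>S. (cmod (b \<alpha>))\<^sup>2)"
proof (rule tendsto_upperbound)
  show "((\<lambda>F. (cmod (\<Sum>\<alpha>\<in>F. a \<alpha> * b \<alpha>))\<^sup>2) \<longlongrightarrow> (cmod (\<Sum>\<^sub>\<infinity>\<alpha>\<in>S. a \<alpha> * b \<alpha>))\<^sup>2)
      (finite_subsets_at_top S)"
    by (intro tendsto_intros infsum_tendsto ab)
  show "\<forall>\<^sub>F F in finite_subsets_at_top S. (cmod (\<Sum>\<alpha>\<in>F. a \<alpha> * b \<alpha>))\<^sup>2
      \<le> (\<Sum>\<^sub>\<infinity>\<alpha>\<in>S. (cmod (a \<alpha>))\<^sup>2) * (\<Sum>\<^sub>\<infinity>\<alpha>\<in>S. (cmod (b \<alpha>))\<^sup>2)"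
  proof (rule eventually_finite_subsets_at_top_weakI)
    fix F assume F: "finite F" "F \<subseteq> S"
    have "cmod (\<Sum>\<alpha>\<in>F. a \<alpha> * b \<alpha>) \<le> (\<Sum>\<alpha>\<in>F. cmod (a \<alpha>) * cmod (b \<alpha>))"
      by (rule order_trans[OF norm_sum]) (simp add: norm_mult)
    then have "(cmod (\<Sum>\<alpha>\<in>F. a \<alpha> * b \<alpha>))\<^sup>2 \<le> (\<Sum>\<alpha>\<in>F. cmod (a \<alpha>) * cmod (b \<alpha>))\<^sup>2"
      by (rule power_mono) simp
    also have "\<dots> \<le> (\<Sum>\<alpha>\<in>F. (cmod (a \<alpha>))\<^sup>2) * (\<Sum>\<alpha>\<in>F. (cmod (b \<alpha>))\<^sup>2)"
      by (rule Cauchy_Schwarz_ineq_sum)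
    also have "\<dots> \<le> (\<Sum>\<^sub>\<infinity>\<alpha>\<in>S. (cmod (a \<alpha>))\<^sup>2) * (\<Sum>\<^sub>\<infinity>\<alpha>\<in>S. (cmod (b \<alpha>))\<^sup>2)"
      by (intro mult_mono finite_sum_le_infsum a b F sum_nonneg infsum_nonneg) auto
    finally show "(cmod (\<Sum>\<alpha>\<in>F. a \<alpha> * b \<alpha>))\<^sup>2
      \<le> (\<Sum>\<^sub>\<infinity>\<alpha>\<in>S. (cmod (a \<alpha>))\<^sup>2) * (\<Sum>\<^sub>\<infinity>\<alpha>\<in>S. (cmod (b \<alpha>))\<^sup>2)" .
  qed
qed simp

text \<open>If \<open>N\<close> were unbounded, a vector could be placed on indices where
  \<open>N\<close> grows geometrically: square-summable itself, yet with weighted squares that do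
  not tend to 0.\<close>

lemma bounded_of_summable_l2:
  fixes N :: "'a \<Rightarrow> real"
  assumes "\<And>x. x \<in> l2 \<Longrightarrow> (\<lambda>\<theta>. N \<theta> * (cmod (x \<theta>))\<^sup>2) summable_on UNIV"
  shows "\<exists>M. \<forall>\<theta>. N \<theta> \<le> M"
proof (rule ccontr)
  assume "\<not> ?thesis"
  then have large: "\<exists>\<theta>. N \<theta> > M" for M
    by (meson not_le)
  \<comment> \<open>Strict growth of \<open>N\<close> along \<open>f\<close> is demanded so that
    \<open>f\<close> is injective.\<close>
  have "\<exists>f. \<forall>n. 4 ^ n \<le> N (f n) \<and> N (f n) < N (f (Suc n))"
  proof (rule dependent_nat_choice)
    show "\<exists>\<theta>. 4 ^ 0 \<le> N \<theta>"
      using large[of 1] by (auto intro: less_imp_le)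
    show "\<exists>\<theta>'. 4 ^ Suc n \<le> N \<theta>' \<and> N \<theta> < N \<theta>'" for \<theta> and n :: nat
      using large[of "max (4 ^ Suc n) (N \<theta>)"] by (auto intro: less_imp_le)
  qed
  then obtain f where f: "\<And>n::nat. 4 ^ n \<le> N (f n)" "\<And>n. N (f n) < N (f (Suc n))"
    by blast
  have "strict_mono (\<lambda>n. N (f n))"
    using f(2) by (simp add: strict_mono_Suc_iff)
  then have inj: "inj f"
    by (metis (mono_tags, lifting) injI strict_mono_eq)
  \<comment> \<open>The squared moduli along \<open>f\<close> are \<open>(1/4) ^ n\<close>:
    summable, but exactly cancelled by the lower bound \<open>4 ^ n\<close> for
    \<open>N (f n)\<close>.\<close>
  define x :: "'a \<Rightarrow> complex" where
    "x = (\<lambda>\<theta>. if \<theta> \<in> range f then (1/2) ^ (inv f \<theta>) else 0)"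
  have xf: "(cmod (x (f n)))\<^sup>2 = (1/4) ^ n" for n
  proof -
    have "cmod (x (f n)) = (1/2) ^ n"
      using inj by (simp add: x_def norm_power norm_divide)
    then have "(cmod (x (f n)))\<^sup>2 = ((1/2)\<^sup>2) ^ n"
      by (metis power_mult mult.commute)
    then show ?thesis by (simp add: power2_eq_square)
  qed
  have "(\<lambda>n. (1/4::real) ^ n) summable_on UNIV"
    by (subst summable_on_UNIV_nonneg_real_iff) (auto intro: summable_geometric)
  then have "((\<lambda>\<theta>. (cmod (x \<theta>))\<^sup>2) \<circ> f) summable_on UNIV"
    by (simp add: o_def xf)
  then have "(\<lambda>\<theta>. (cmod (x \<theta>))\<^sup>2) summable_on range f"
    using summable_on_reindex[OF inj] by blast
  then have "(\<lambda>\<theta>. (cmod (x \<theta>))\<^sup>2) summable_on UNIV"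
    by (rule summable_on_cong_neutral[THEN iffD1, rotated -1]) (auto simp: x_def)
  then have "x \<in> l2"
    by (simp add: l2_def)
  from assms[OF this] have "(\<lambda>\<theta>. N \<theta> * (cmod (x \<theta>))\<^sup>2) summable_on range f"
    by (rule summable_on_subset_banach) simp
  then have "((\<lambda>\<theta>. N \<theta> * (cmod (x \<theta>))\<^sup>2) \<circ> f) summable_on UNIV"
    using summable_on_reindex[OF inj] by blast
  then have "summable (\<lambda>n. N (f n) * (1/4) ^ n)"
    using summable_on_imp_summable by (simp add: o_def xf)
  then have "(\<lambda>n. N (f n) * (1/4) ^ n) \<longlonglongrightarrow> 0"
    by (rule summable_LIMSEQ_zero)
  then have "1 \<le> (0::real)"
  proof (rule tendsto_lowerbound)
    have "1 \<le> N (f n) * (1/4) ^ n" for n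
    proof -
      have "1 = 4 ^ n * (1/4 :: real) ^ n"
        by (simp flip: power_mult_distrib)
      also have "\<dots> \<le> N (f n) * (1/4) ^ n"
        by (rule mult_right_mono[OF f(1)]) simp
      finally show ?thesis .
    qed
    then show "\<forall>\<^sub>F n in sequentially. 1 \<le> N (f n) * (1/4) ^ n"
      by simp
  qed simp
  then show False by simp
qed

section \<open>Closure properties of \<open>l2\<close>\<close>

lemma l2_summable_on:
  "x \<in> l2 \<Longrightarrow> (\<lambda>\<alpha>. (cmod (x \<alpha>))\<^sup>2) summable_on S"
  unfolding l2_def using summable_on_subset_banach by blast

lemma l2_zero: "(\<lambda>_. 0) \<in> l2"
  by (simp add: l2_def)

lemma l2_add:
  assumes "x \<in> l2" "y \<in> l2"
  shows "(\<lambda>\<theta>. x \<theta> + y \<theta>) \<in> l2"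
proof -
  have s: "(\<lambda>\<alpha>. 2 * (cmod (x \<alpha>))\<^sup>2 + 2 * (cmod (y \<alpha>))\<^sup>2) summable_on UNIV"
    using assms by (auto simp: l2_def intro!: summable_on_add summable_on_cmult_right)
  have "(\<lambda>\<alpha>. (cmod (x \<alpha> + y \<alpha>))\<^sup>2) summable_on UNIV"
  proof (rule summable_on_comparison_test[OF s])
    fix \<alpha>
    have "(cmod (x \<alpha> + y \<alpha>))\<^sup>2 \<le> (cmod (x \<alpha>) + cmod (y \<alpha>))\<^sup>2"
      by (intro power_mono norm_triangle_ineq) simp
    also have "\<dots> \<le> 2 * (cmod (x \<alpha>))\<^sup>2 + 2 * (cmod (y \<alpha>))\<^sup>2"
      using zero_le_power2[of "cmod (x \<alpha>) - cmod (y \<alpha>)"]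
      unfolding power2_sum power2_diff by linarith
    finally show "(cmod (x \<alpha> + y \<alpha>))\<^sup>2 \<le> 2 * (cmod (x \<alpha>))\<^sup>2 + 2 * (cmod (y \<alpha>))\<^sup>2" .
  qed simp
  then show ?thesis by (simp add: l2_def)
qed

lemma l2_sum:
  "finite I \<Longrightarrow> (\<And>i. i \<in> I \<Longrightarrow> f i \<in> l2) \<Longrightarrow> (\<lambda>\<theta>. \<Sum>i\<in>I. f i \<theta>) \<in> l2"
  by (induction I rule: finite_induct) (auto intro: l2_zero l2_add)

section \<open>Bounds on the weights\<close>

lemma wgs_in_l2: "wgs \<phi> w ` l2 \<subseteq> l2 \<Longrightarrow> x \<in> l2 \<Longrightarrow> wgs \<phi> w x \<in> l2"
  by blast

text \<open>The image of the unit vector at \<theta> is \<open>w\<close> cut off to the fibre over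
  \<theta>.\<close>

lemma weight_fibre_summable:
  assumes "wgs \<phi> w ` l2 \<subseteq> l2"
  shows "(\<lambda>\<alpha>. (cmod (w \<alpha>))\<^sup>2) summable_on (\<phi> -` {\<theta>})"
proof -
  have "wgs \<phi> w (\<lambda>\<alpha>. if \<alpha> = \<theta> then 1 else 0) \<in> l2"
    by (rule wgs_in_l2[OF assms unit_in_l2])
  then have "(\<lambda>\<alpha>. (cmod (w \<alpha> * (if \<phi> \<alpha> = \<theta> then 1 else 0)))\<^sup>2) summable_on UNIV"
    by (simp add: l2_def wgs_def)
  then show ?thesis
    by (rule summable_on_cong_neutral[THEN iffD1, rotated -1]) auto
qed

text \<open>Grouped by fibres, the squared norm of \<open>wgs \<phi> w x\<close> is the sum of the
  squares \<open>(cmod (x \<theta>))\<^sup>2\<close> weighted by the fibre sums, so the gliding hump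
  applies to these sums.\<close>

lemma weight_fibre_bounded:
  assumes "wgs \<phi> w ` l2 \<subseteq> l2"
  shows "\<exists>M. \<forall>\<theta>. (\<Sum>\<^sub>\<infinity>\<alpha>\<in>\<phi> -` {\<theta>}. (cmod (w \<alpha>))\<^sup>2) \<le> M"
proof (rule bounded_of_summable_l2)
  fix x :: "'a \<Rightarrow> complex" assume "x \<in> l2"
  then have "wgs \<phi> w x \<in> l2"
    by (rule wgs_in_l2[OF assms])
  then have "(\<lambda>\<alpha>. (cmod (w \<alpha> * x (\<phi> \<alpha>)))\<^sup>2) summable_on UNIV"
    by (simp add: l2_def wgs_def)
  then have "(\<lambda>\<theta>. \<Sum>\<^sub>\<infinity>\<alpha>\<in>\<phi> -` {\<theta>}. (cmod (w \<alpha> * x (\<phi> \<alpha>)))\<^sup>2) summable_on UNIV"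
    by (rule summable_on_fibres)
  also have "(\<lambda>\<theta>. \<Sum>\<^sub>\<infinity>\<alpha>\<in>\<phi> -` {\<theta>}. (cmod (w \<alpha> * x (\<phi> \<alpha>)))\<^sup>2)
      = (\<lambda>\<theta>. \<Sum>\<^sub>\<infinity>\<alpha>\<in>\<phi> -` {\<theta>}. (cmod (w \<alpha>))\<^sup>2 * (cmod (x \<theta>))\<^sup>2)"
    by (intro ext infsum_cong) (auto simp: norm_mult power_mult_distrib)
  also have "\<dots> = (\<lambda>\<theta>. (\<Sum>\<^sub>\<infinity>\<alpha>\<in>\<phi> -` {\<theta>}. (cmod (w \<alpha>))\<^sup>2) * (cmod (x \<theta>))\<^sup>2)"
    by (intro ext infsum_cmult_left')
  finally show "(\<lambda>\<theta>. (\<Sum>\<^sub>\<infinity>\<alpha>\<in>\<phi> -` {\<theta>}. (cmod (w \<alpha>))\<^sup>2) * (cmod (x \<theta>))\<^sup>2) summable_on UNIV" .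
qed

lemma weight_bounded:
  assumes "wgs \<phi> w ` l2 \<subseteq> l2"
  shows "\<exists>M. \<forall>\<alpha>. (cmod (w \<alpha>))\<^sup>2 \<le> M"
proof -
  obtain M where M: "\<And>\<theta>. (\<Sum>\<^sub>\<infinity>\<alpha>\<in>\<phi> -` {\<theta>}. (cmod (w \<alpha>))\<^sup>2) \<le> M"
    using weight_fibre_bounded[OF assms] by blast
  have "(cmod (w \<alpha>))\<^sup>2 \<le> M" for \<alpha>
    using finite_sum_le_infsum[OF weight_fibre_summable[OF assms], of "{\<alpha>}" "\<phi> \<alpha>"] M[of "\<phi> \<alpha>"]
    by force
  then show ?thesis by blast
qed

section \<open>The adjoint as a sum over fibres\<close>

text \<open>These are the terms of the inner product of \<open>y\<close> with the image of the unit
  vector at \<theta>, which is the coordinate at \<theta> of the adjoint.\<close>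

lemma adjoint_fibre_summable:
  assumes "wgs \<phi> w ` l2 \<subseteq> l2" "y \<in> l2"
  shows "(\<lambda>\<alpha>. cnj (w \<alpha>) * y \<alpha>) summable_on (\<phi> -` {\<theta>})"
proof -
  have "(\<lambda>\<alpha>. y \<alpha> * cnj (wgs \<phi> w (\<lambda>\<alpha>. if \<alpha> = \<theta> then 1 else 0) \<alpha>)) summable_on UNIV"
    by (intro l2_inner_summable wgs_in_l2 unit_in_l2 assms)
  then show ?thesis
    by (rule summable_on_cong_neutral[THEN iffD1, rotated -1]) (auto simp: wgs_def)
qed

text \<open>Cauchy-Schwarz on each fibre bounds \<open>(cmod (z \<theta>))\<^sup>2\<close> by
  \<open>M\<close> times the fibre sum of the squares of \<open>y\<close>, and these fibre sums are
  summable. The adjoint identity is the inner product regrouped by fibres.\<close>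

lemma l2_adjoint_wgs:
  assumes T: "wgs \<phi> w ` l2 \<subseteq> l2" and y: "y \<in> l2"
  defines "z \<equiv> \<lambda>\<theta>. \<Sum>\<^sub>\<infinity>\<alpha>\<in>\<phi> -` {\<theta>}. cnj (w \<alpha>) * y \<alpha>"
  shows "z \<in> l2" "l2_adjoint (wgs \<phi> w) y = z"
proof -
  obtain M where M: "\<And>\<theta>. (\<Sum>\<^sub>\<infinity>\<alpha>\<in>\<phi> -` {\<theta>}. (cmod (w \<alpha>))\<^sup>2) \<le> M"
    using weight_fibre_bounded[OF T] by blast
  have "(\<lambda>\<theta>. M * (\<Sum>\<^sub>\<infinity>\<alpha>\<in>\<phi> -` {\<theta>}. (cmod (y \<alpha>))\<^sup>2)) summable_on UNIV"
    by (intro summable_on_cmult_right summable_on_fibres l2_summable_on y)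
  then have "(\<lambda>\<theta>. (cmod (z \<theta>))\<^sup>2) summable_on UNIV"
  proof (rule summable_on_comparison_test)
    fix \<theta>
    have "(cmod (z \<theta>))\<^sup>2 \<le> (\<Sum>\<^sub>\<infinity>\<alpha>\<in>\<phi> -` {\<theta>}. (cmod (cnj (w \<alpha>)))\<^sup>2) * (\<Sum>\<^sub>\<infinity>\<alpha>\<in>\<phi> -` {\<theta>}. (cmod (y \<alpha>))\<^sup>2)"
      unfolding z_def
      using weight_fibre_summable[OF T] l2_summable_on[OF y] adjoint_fibre_summable[OF T y]
      by (intro infsum_Cauchy_Schwarz) auto
    also have "\<dots> \<le> M * (\<Sum>\<^sub>\<infinity>\<alpha>\<in>\<phi> -` {\<theta>}. (cmod (y \<alpha>))\<^sup>2)"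
      using M[of \<theta>] by (intro mult_right_mono infsum_nonneg) auto
    finally show "(cmod (z \<theta>))\<^sup>2 \<le> M * (\<Sum>\<^sub>\<infinity>\<alpha>\<in>\<phi> -` {\<theta>}. (cmod (y \<alpha>))\<^sup>2)" .
  qed simp
  then show z: "z \<in> l2" by (simp add: l2_def)
  show "l2_adjoint (wgs \<phi> w) y = z"
  proof (rule l2_adjoint_eqI[OF z])
    fix x :: "'a \<Rightarrow> complex" assume x: "x \<in> l2"
    have s: "(\<lambda>\<alpha>. wgs \<phi> w x \<alpha> * cnj (y \<alpha>)) summable_on UNIV"
      by (intro l2_inner_summable wgs_in_l2 T x y)
    have "l2_inner (wgs \<phi> w x) y = (\<Sum>\<^sub>\<infinity>\<theta>. \<Sum>\<^sub>\<infinity>\<alpha>\<in>\<phi> -` {\<theta>}. wgs \<phi> w x \<alpha> * cnj (y \<alpha>))"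
      unfolding l2_inner_def by (rule infsum_fibres[OF s, symmetric])
    \<comment> \<open>On the fibre over \<theta> the factor \<open>x (\<phi> \<alpha>)\<close> is
      the constant \<open>x \<theta>\<close>, which then leaves the inner sum.\<close>
    also have "\<dots> = (\<Sum>\<^sub>\<infinity>\<theta>. \<Sum>\<^sub>\<infinity>\<alpha>\<in>\<phi> -` {\<theta>}. x \<theta> * cnj (cnj (w \<alpha>) * y \<alpha>))"
      by (intro infsum_cong) (auto simp: wgs_def)
    also have "\<dots> = (\<Sum>\<^sub>\<infinity>\<theta>. x \<theta> * cnj (z \<theta>))"
      unfolding z_def infsum_cmult_right' infsum_cnj ..
    finally show "l2_inner (wgs \<phi> w x) y = l2_inner x z"
      by (simp add: l2_inner_def)
  qed
qed

section \<open>Construction of the shifts and convergence of the series\<close>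

text \<open>Where the weight is nonzero, each coordinate of the input is read at most once, so the
  squared norm grows by a factor of at most \<open>M\<close>.\<close>

lemma wgs_maps_l2I:
  assumes inj: "inj_on \<eta> {\<theta>. u \<theta> \<noteq> 0}" and M: "\<And>\<theta>. (cmod (u \<theta>))\<^sup>2 \<le> M"
  shows "wgs \<eta> u ` l2 \<subseteq> l2"
proof clarify
  fix x :: "'a \<Rightarrow> complex" assume "x \<in> l2"
  then have "(\<lambda>\<alpha>. (cmod (x \<alpha>))\<^sup>2) summable_on (\<eta> ` {\<theta>. u \<theta> \<noteq> 0})"
    by (rule l2_summable_on)
  then have "((\<lambda>\<alpha>. (cmod (x \<alpha>))\<^sup>2) \<circ> \<eta>) summable_on {\<theta>. u \<theta> \<noteq> 0}"
    using summable_on_reindex[OF inj] by blast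
  then have "(\<lambda>\<theta>. M * (cmod (x (\<eta> \<theta>)))\<^sup>2) summable_on {\<theta>. u \<theta> \<noteq> 0}"
    by (intro summable_on_cmult_right) (simp add: o_def)
  then have "(\<lambda>\<theta>. (cmod (wgs \<eta> u x \<theta>))\<^sup>2) summable_on {\<theta>. u \<theta> \<noteq> 0}"
    by (rule summable_on_comparison_test)
      (auto simp: wgs_def norm_mult power_mult_distrib intro: mult_right_mono M)
  then have "(\<lambda>\<theta>. (cmod (wgs \<eta> u x \<theta>))\<^sup>2) summable_on UNIV"
    by (rule summable_on_cong_neutral[THEN iffD1, rotated -1]) (auto simp: wgs_def)
  then show "wgs \<eta> u x \<in> l2" by (simp add: l2_def)
qed

text \<open>A summable family has countable support, so the nonzero weights of each fibre can be
  numbered. One function \<open>e\<close> serves all fibres because they are disjoint.\<close>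

lemma fibre_enumeration:
  assumes "wgs \<phi> w ` l2 \<subseteq> l2"
  shows "\<exists>e :: 'a \<Rightarrow> nat. (\<forall>\<theta>. inj_on e {\<alpha>. \<phi> \<alpha> = \<theta> \<and> w \<alpha> \<noteq> 0}) \<and> (\<forall>\<alpha>. e \<alpha> \<noteq> 0)"
proof -
  define S where "S \<theta> = {\<alpha>. \<phi> \<alpha> = \<theta> \<and> w \<alpha> \<noteq> 0}" for \<theta>
  \<comment> \<open>\<open>Suc\<close> keeps 0 out of the range, since the series starts at index
    1.\<close>
  define e where "e \<alpha> = Suc (to_nat_on (S (\<phi> \<alpha>)) \<alpha>)" for \<alpha>
  have "inj_on e {\<alpha>. \<phi> \<alpha> = \<theta> \<and> w \<alpha> \<noteq> 0}" for \<theta>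
  proof -
    have "countable {\<alpha> \<in> \<phi> -` {\<theta>}. (cmod (w \<alpha>))\<^sup>2 \<noteq> 0}"
      using weight_fibre_summable[OF assms] by (intro summable_countable_real) auto
    then have "countable (S \<theta>)"
      by (simp add: S_def)
    then have "inj_on (to_nat_on (S \<theta>)) (S \<theta>)"
      by (rule inj_on_to_nat_on)
    then have "inj_on e (S \<theta>)"
      by (auto simp: inj_on_def e_def S_def)
    then show ?thesis by (simp add: S_def)
  qed
  moreover have "e \<alpha> \<noteq> 0" for \<alpha>
    by (simp add: e_def)
  ultimately show ?thesis by blast
qed

theorem theorem2p1:
  fixes A :: "complex set" and \<phi> :: "'a \<Rightarrow> 'a" and w :: "'a \<Rightarrow> complex"
  assumes "conjugate_invariant A"
    and "weighted_in A w"
    and "wgs \<phi> w ` l2 \<subseteq> l2"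
  shows "\<exists>(\<eta> :: nat \<Rightarrow> 'a \<Rightarrow> 'a) (u :: nat \<Rightarrow> 'a \<Rightarrow> complex).
    (\<forall>i\<ge>1. weighted_in (A \<union> {0}) (u i) \<and> wgs (\<eta> i) (u i) ` l2 \<subseteq> l2) \<and>
    (\<forall>y\<in>l2. limitin l2p (\<lambda>n \<theta>. \<Sum>i=1..n. wgs (\<eta> i) (u i) y \<theta>)
               (l2_adjoint (wgs \<phi> w) y) sequentially)"
proof -
  note T = assms(3)
  obtain e :: "'a \<Rightarrow> nat" where e: "\<And>\<theta>. inj_on e {\<alpha>. \<phi> \<alpha> = \<theta> \<and> w \<alpha> \<noteq> 0}" "\<And>\<alpha>. e \<alpha> \<noteq> 0"
    using fibre_enumeration[OF T] by blast
  obtain M where M: "\<And>\<alpha>. (cmod (w \<alpha>))\<^sup>2 \<le> M"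
    using weight_bounded[OF T] by blast
  define S where "S \<theta> = {\<alpha>. \<phi> \<alpha> = \<theta> \<and> w \<alpha> \<noteq> 0}" for \<theta>
  \<comment> \<open>This is the element numbered \<open>i\<close> in the fibre over \<theta>. If
    there is none the value is arbitrary, and the weight 0 in \<open>u\<close> suppresses it; this
    default is where \<open>A \<union> {0}\<close> comes from.\<close>
  define \<eta> where "\<eta> i \<theta> = inv_into (S \<theta>) e i" for i \<theta>
  define u where "u i \<theta> = (if i \<in> e ` S \<theta> then cnj (w (\<eta> i \<theta>)) else 0)" for i \<theta>
  have inj: "inj_on e (S \<theta>)" for \<theta>
    using e(1) by (simp add: S_def)
  have \<eta>_e: "\<eta> (e \<alpha>) \<theta> = \<alpha>" if "\<alpha> \<in> S \<theta>" for \<alpha> \<theta>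
    using inv_into_f_f[OF inj that] by (simp add: \<eta>_def)
  have M0: "0 \<le> M"
    using order_trans[OF zero_le_power2 M] .
  have u_in: "weighted_in (A \<union> {0}) (u i)" for i
    using assms(1,2) by (auto simp: weighted_in_def conjugate_invariant_def u_def)
  have u_l2: "wgs (\<eta> i) (u i) ` l2 \<subseteq> l2" for i
  proof (rule wgs_maps_l2I)
    \<comment> \<open>Thus \<phi> is a left inverse of \<open>\<eta> i\<close> on the support of
      \<open>u i\<close>, which gives injectivity there.\<close>
    have "\<phi> (\<eta> i \<theta>) = \<theta>" if "u i \<theta> \<noteq> 0" for \<theta>
    proof -
      have "i \<in> e ` S \<theta>" using that by (auto simp: u_def split: if_splits)
      then have "\<eta> i \<theta> \<in> S \<theta>" unfolding \<eta>_def by (rule inv_into_into)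
      then show ?thesis by (simp add: S_def)
    qed
    then show "inj_on (\<eta> i) {\<theta>. u i \<theta> \<noteq> 0}"
      by (intro inj_on_inverseI[where g = \<phi>]) auto
    show "(cmod (u i \<theta>))\<^sup>2 \<le> M" for \<theta>
      using M M0 by (simp add: u_def)
  qed
  have lim: "(\<lambda>n. \<Sum>i=1..n. wgs (\<eta> i) (u i) y \<theta>)
      \<longlonglongrightarrow> (\<Sum>\<^sub>\<infinity>\<alpha>\<in>\<phi> -` {\<theta>}. cnj (w \<alpha>) * y \<alpha>)" (is "_ \<longlonglongrightarrow> ?z") if y: "y \<in> l2" for y \<theta>
  proof -
    define g where "g i = wgs (\<eta> i) (u i) y \<theta>" for i
    have g_e: "g (e \<alpha>) = cnj (w \<alpha>) * y \<alpha>" if "\<alpha> \<in> S \<theta>" for \<alpha>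
      using that by (simp add: g_def wgs_def u_def \<eta>_e)
    have g_0: "g i = 0" if "i \<notin> e ` S \<theta>" for i
      using that by (simp add: g_def wgs_def u_def)
    have "((\<lambda>\<alpha>. cnj (w \<alpha>) * y \<alpha>) has_sum ?z) (\<phi> -` {\<theta>})"
      using adjoint_fibre_summable[OF T y] by (rule has_sum_infsum)
    then have "((\<lambda>\<alpha>. g (e \<alpha>)) has_sum ?z) (S \<theta>)"
      by (rule has_sum_cong_neutral[THEN iffD1, rotated -1]) (auto simp: S_def g_e)
    then have "(g has_sum ?z) (e ` S \<theta>)"
      by (simp add: has_sum_reindex[OF inj] o_def)
    then have "(g has_sum ?z) UNIV"
      by (rule has_sum_cong_neutral[THEN iffD1, rotated -1]) (auto simp: g_0)
    then have "g sums ?z"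
      by (rule has_sum_imp_sums)
    then have "(\<lambda>n. \<Sum>i\<le>n. g i) \<longlonglongrightarrow> ?z"
      by (simp add: sums_def_le)
    \<comment> \<open>The ordered series starts at 0, the required one at 1.\<close>
    moreover have "g 0 = 0"
      using e(2) by (intro g_0) (metis image_iff)
    then have "(\<Sum>i\<le>n. g i) = (\<Sum>i=1..n. g i)" for n
      by (intro sum.mono_neutral_right) (auto simp: not_le)
    ultimately show ?thesis
      by (simp add: g_def)
  qed
  have "limitin l2p (\<lambda>n \<theta>. \<Sum>i=1..n. wgs (\<eta> i) (u i) y \<theta>)
      (l2_adjoint (wgs \<phi> w) y) sequentially" if y: "y \<in> l2" for y
    unfolding limitin_l2p_iff l2_adjoint_wgs(2)[OF T y]
    using l2_adjoint_wgs(1)[OF T y] lim[OF y] u_l2 y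
    by (auto intro!: always_eventually l2_sum)
  with u_in u_l2 show ?thesis by blast
qed

end
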